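(* Let $\alpha_1,\alpha_2>-1$ with $\alpha_1-\alpha_2\notin\mathbb Z$, and let $n_1,n_2\ge1$ be integers. Let $L^{(1)}_{(n_1,n_2)},L^{(2)}_{(n_1,n_2)}$ be the Laguerre I multiple orthogonal polynomials of type I (for the weights $\omega_a(x)=e^{-x}x^{\alpha_a}$, $a\in\{1,2\}$, and Lebesgue measure on $[0,\infty)$) biorthogonal to the monic Laguerre I polynomials of type II. Then, for $a\in\{1,2\}$, $$L^{(a)}_{(n_1,n_2)}(x)=\frac{(-1)^{n_1+n_2-1}}{(n_a-1)!\,\Gamma(\alpha_a+1)\,(\hat\alpha_a-\alpha_a)_{\hat n_a}}\;{}_2F_2\!\left[{-n_a+1,\ \alpha_a-\hat\alpha_a-\hat n_a+1\atop\alpha_a+1,\ \alpha_a-\hat\alpha_a+1};x\right]$$ $$=\frac{(-1)^{n_1+n_2-1}}{(n_a-1)!\,\Gamma(\alpha_a+1)\,(\hat\alpha_a-\alpha_a)_{\hat n_a}}\sum_{l=0}^{n_a-1}\frac{(-n_a+1)_l}{l!}\frac{(\alpha_a-\hat\alpha_a-\hat n_a+1)_l}{(\alpha_a+1)_l\,(\alpha_a-\hat\alpha_a+1)_l}\,x^l.$$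
   Context: Pochhammer symbol: $(x)_0=1$, $(x)_n=x(x+1)\cdots(x+n-1)$. Notation: $\hat\alpha_1=\alpha_2$, $\hat\alpha_2=\alpha_1$, $\hat n_1=n_2$, $\hat n_2=n_1$. The type II polynomial $L_{(m_1,m_2)}$, $m_1,m_2\ge0$, is the unique monic polynomial of degree $m_1+m_2$ with $\int_0^\infty x^jL_{(m_1,m_2)}(x)\,\omega_a(x)\,dx=0$ for $j\in\{0,\dots,m_a-1\}$, $a\in\{1,2\}$. The type I polynomials biorthogonal to them are the unique pair with $\deg L^{(a)}_{(n_1,n_2)}\le n_a-1$ such that $$\int_0^\infty x^j\big(L^{(1)}_{(n_1,n_2)}(x)\omega_1(x)+L^{(2)}_{(n_1,n_2)}(x)\omega_2(x)\big)\,dx=0,\quad j\in\{0,\dots,n_1+n_2-2\},$$ and $$\int_0^\infty L_{(m_1,m_2)}(x)\big(L^{(1)}_{(n_1,n_2)}(x)\omega_1(x)+L^{(2)}_{(n_1,n_2)}(x)\omega_2(x)\big)\,dx=1\quad\text{whenever }m_1+m_2=n_1+n_2-1$$ (equivalently, since $L_{(m_1,m_2)}$ is monic, the integral with $x^{n_1+n_2-1}$ in place of $L_{(m_1,m_2)}(x)$ equals $1$). *)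

theory Defs
  imports "HOL-Analysis.Analysis"
begin

text \<open>
  At \<open>x = 0\<close> the library has \<open>0 powr \<alpha> = 0\<close> for every \<open>\<alpha>\<close>; this affects the weight on a
  null set only, so no integral below depends on it.
\<close>
definition laguerre_weight :: "real \<Rightarrow> real \<Rightarrow> real" where
  "laguerre_weight \<alpha> x = exp (- x) * x powr \<alpha>"

text \<open>Type II polynomials \<open>L\<^sub>(\<^sub>m\<^sub>1\<^sub>,\<^sub>m\<^sub>2\<^sub>)\<close> for the weights with exponents \<open>\<alpha>1\<close> and \<open>\<alpha>2\<close>.\<close>
definition is_laguerre_type_II :: "real \<Rightarrow> real \<Rightarrow> nat \<Rightarrow> nat \<Rightarrow> real poly \<Rightarrow> bool" where
  "is_laguerre_type_II \<alpha>1 \<alpha>2 m1 m2 P \<longleftrightarrow>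
     lead_coeff P = 1 \<and> degree P = m1 + m2 \<and>
     (\<forall>j<m1. (LBINT x:{0..}. x ^ j * poly P x * laguerre_weight \<alpha>1 x) = 0) \<and>
     (\<forall>j<m2. (LBINT x:{0..}. x ^ j * poly P x * laguerre_weight \<alpha>2 x) = 0)"

definition laguerre_type_II :: "real \<Rightarrow> real \<Rightarrow> nat \<Rightarrow> nat \<Rightarrow> real poly" where
  "laguerre_type_II \<alpha>1 \<alpha>2 m1 m2 = (THE P. is_laguerre_type_II \<alpha>1 \<alpha>2 m1 m2 P)"

text \<open>
  Pairs of type I polynomials. Bounds with truncated subtraction are avoided:
  \<open>A = 0 \<or> degree A < n\<close> says that the degree is at most \<open>n - 1\<close> (forcing \<open>A = 0\<close> if \<open>n = 0\<close>),
  and \<open>j + 2 \<le> n1 + n2\<close> says that \<open>j\<close> ranges over \<open>0, \<dots>, n1 + n2 - 2\<close>.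
\<close>
definition is_laguerre_type_I ::
    "real \<Rightarrow> real \<Rightarrow> nat \<Rightarrow> nat \<Rightarrow> real poly \<times> real poly \<Rightarrow> bool" where
  "is_laguerre_type_I \<alpha>1 \<alpha>2 n1 n2 = (\<lambda>(A1, A2).
     (A1 = 0 \<or> degree A1 < n1) \<and> (A2 = 0 \<or> degree A2 < n2) \<and>
     (\<forall>j. j + 2 \<le> n1 + n2 \<longrightarrow>
        (LBINT x:{0..}. x ^ j *
           (poly A1 x * laguerre_weight \<alpha>1 x + poly A2 x * laguerre_weight \<alpha>2 x)) = 0) \<and>
     (\<forall>m1 m2. m1 + m2 + 1 = n1 + n2 \<longrightarrow>
        (LBINT x:{0..}. poly (laguerre_type_II \<alpha>1 \<alpha>2 m1 m2) x *
           (poly A1 x * laguerre_weight \<alpha>1 x + poly A2 x * laguerre_weight \<alpha>2 x)) = 1))"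

definition laguerre_type_I ::
    "real \<Rightarrow> real \<Rightarrow> nat \<Rightarrow> nat \<Rightarrow> real poly \<times> real poly" where
  "laguerre_type_I \<alpha>1 \<alpha>2 n1 n2 = (THE A. is_laguerre_type_I \<alpha>1 \<alpha>2 n1 n2 A)"

definition laguerre_type_I_1 :: "real \<Rightarrow> real \<Rightarrow> nat \<Rightarrow> nat \<Rightarrow> real poly" where
  "laguerre_type_I_1 \<alpha>1 \<alpha>2 n1 n2 = fst (laguerre_type_I \<alpha>1 \<alpha>2 n1 n2)"

definition laguerre_type_I_2 :: "real \<Rightarrow> real \<Rightarrow> nat \<Rightarrow> nat \<Rightarrow> real poly" where
  "laguerre_type_I_2 \<alpha>1 \<alpha>2 n1 n2 = snd (laguerre_type_I \<alpha>1 \<alpha>2 n1 n2)"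

text \<open>
  The generalised hypergeometric function with upper parameters \<open>as\<close> and lower parameters \<open>bs\<close>.
  The third argument of \<^const>\<open>fps_hypergeo\<close> is a scaling factor of the variable.
\<close>
definition hypergeo :: "real list \<Rightarrow> real list \<Rightarrow> real \<Rightarrow> real" where
  "hypergeo as bs x = eval_fps (fps_hypergeo as bs 1) x"

end

theory Submission
  imports Defs
begin

text \<open>
  Since \<open>\<integral> x\<^sup>k x\<^sup>t e\<^sup>-\<^sup>x dx = \<Gamma>(t + 1) (t + 1)\<^sub>k\<close>, integrating a polynomial \<open>P = \<Sum> p\<^sub>k x\<^sup>k\<close> against
  \<open>x\<^sup>t e\<^sup>-\<^sup>x\<close> gives \<open>\<Gamma>(t + 1) Q(t)\<close> with \<open>Q(t) = \<Sum> p\<^sub>k (t + 1)\<^sub>k\<close>, and \<open>P \<mapsto> Q\<close> is a linear bijection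
  preserving degree and leading coefficient. Let \<open>t\<^sub>i\<close> run through the nodes \<open>\<alpha>\<^sub>a + l\<close> with
  \<open>l < n\<^sub>a\<close>, which are distinct because \<open>\<alpha>\<^sub>1 - \<alpha>\<^sub>2\<close> is not an integer. Type II orthogonality
  then says \<open>Q = \<Prod> (t - t\<^sub>i)\<close>. For the type I pair, let \<open>c\<^sub>i\<close> be the coefficient of \<open>x\<^sup>l\<close> times
  \<open>\<Gamma>(t\<^sub>i + 1)\<close>; biorthogonality says that \<open>Q \<mapsto> \<Sum> c\<^sub>i Q(t\<^sub>i)\<close> extracts the coefficient of
  degree \<open>n\<^sub>1 + n\<^sub>2 - 1\<close> from every \<open>Q\<close> of at most that degree. By Lagrange interpolation this
  determines \<open>c\<^sub>i = 1 / \<Prod>\<^sub>k (t\<^sub>i - t\<^sub>k)\<close>, the product being over \<open>k \<noteq> i\<close>, and rewriting these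
  products as Pochhammer symbols gives the hypergeometric formula.
\<close>

section \<open>The bijection from monomials to rising factorials\<close>

definition rising_poly :: "real poly \<Rightarrow> real poly" where
  "rising_poly p = (\<Sum>k\<le>degree p. smult (coeff p k) (pochhammer [:1, 1:] k))"

lemma poly_pochhammer_poly: "poly (pochhammer p k) t = pochhammer (poly p t) k"
  by (induction k) (simp_all add: pochhammer_Suc of_nat_poly)

lemma degree_pochhammer_linear: "degree (pochhammer [:a, 1:] k) = k"
  and lead_coeff_pochhammer_linear: "coeff (pochhammer [:a, 1:] k) k = 1"
  for a :: real
proof -
  \<comment> \<open>Both claims go through one induction: the leading coefficient 1 shows the factor
    to be nonzero, which additivity of degrees requires.\<close>
  have *: "degree (pochhammer [:a, 1:] k) = k \<and> lead_coeff (pochhammer [:a, 1:] k) = 1"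
  proof (induction k)
    case (Suc k)
    have eq: "pochhammer [:a, 1:] (Suc k) = pochhammer [:a, 1:] k * [:a + real k, 1:]"
      by (simp add: pochhammer_Suc of_nat_poly)
    have nz: "pochhammer [:a, 1:] k \<noteq> 0"
      using Suc.IH by auto
    have "degree (pochhammer [:a, 1:] (Suc k)) = Suc k"
      unfolding eq using Suc.IH nz by (subst degree_mult_eq) auto
    moreover have "lead_coeff (pochhammer [:a, 1:] (Suc k)) = 1"
      unfolding eq lead_coeff_mult using conjunct2[OF Suc.IH] by (simp del: One_nat_def)
    ultimately show ?case by blast
  qed simp
  show deg: "degree (pochhammer [:a, 1:] k) = k"
    using * by blast
  show "coeff (pochhammer [:a, 1:] k) k = 1"
    using conjunct2[OF *] unfolding deg .
qed

text \<open>The defining sum stops at the degree of its argument. Padding with zero coefficients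
  gives a common range, so that the sums of two polynomials can be combined.\<close>

lemma rising_poly_altdef:
  assumes "degree p \<le> n"
  shows "rising_poly p = (\<Sum>k\<le>n. smult (coeff p k) (pochhammer [:1, 1:] k))"
  unfolding rising_poly_def using assms
  by (intro sum.mono_neutral_left) (auto simp: coeff_eq_0)

lemma poly_rising_poly:
  assumes "degree p \<le> n"
  shows "poly (rising_poly p) t = (\<Sum>k\<le>n. coeff p k * pochhammer (t + 1) k)"
  by (simp add: rising_poly_altdef[OF assms] poly_sum poly_pochhammer_poly add.commute)

lemma degree_rising_poly_le: "degree (rising_poly p) \<le> degree p"
  unfolding rising_poly_def
  by (intro degree_sum_le order.trans[OF degree_smult_le]) (auto simp: degree_pochhammer_linear)

text \<open>The rising factorial of index \<open>k\<close> is monic of degree \<open>k\<close>, so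
  among the indices up to \<open>n\<close> only \<open>k = n\<close> reaches degree
  \<open>n\<close>.\<close>

lemma coeff_rising_poly:
  assumes "degree p \<le> n"
  shows "coeff (rising_poly p) n = coeff p n"
proof -
  have "coeff (rising_poly p) n = (\<Sum>k\<le>n. coeff p k * coeff (pochhammer [:1, 1:] k) n)"
    by (simp add: rising_poly_altdef[OF assms] coeff_sum)
  also have "\<dots> = (\<Sum>k\<in>{n}. coeff p k * coeff (pochhammer [:1, 1:] k) n)"
    by (intro sum.mono_neutral_right) (auto simp: coeff_eq_0 degree_pochhammer_linear)
  finally show ?thesis
    by (simp add: lead_coeff_pochhammer_linear)
qed

lemma degree_rising_poly [simp]: "degree (rising_poly p) = degree p"
proof (cases "p = 0")
  case False
  then have "coeff (rising_poly p) (degree p) \<noteq> 0"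
    by (simp add: coeff_rising_poly)
  then show ?thesis
    using degree_rising_poly_le[of p] le_degree by (metis order.antisym)
qed (simp add: rising_poly_def)

lemma rising_poly_add: "rising_poly (p + q) = rising_poly p + rising_poly q"
proof -
  define n where "n = max (degree p) (degree q)"
  have "degree p \<le> n" "degree q \<le> n" "degree (p + q) \<le> n"
    unfolding n_def by (auto simp: degree_add_le_max)
  then show ?thesis
    by (simp add: rising_poly_altdef[where n = n] smult_add_left sum.distrib)
qed

lemma rising_poly_smult: "rising_poly (smult c p) = smult c (rising_poly p)"
proof -
  have "rising_poly (smult c p) =
      (\<Sum>k\<le>degree p. smult c (smult (coeff p k) (pochhammer [:1, 1:] k)))"
    by (simp add: rising_poly_altdef[OF degree_smult_le])
  also have "\<dots> = smult c (rising_poly p)"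
    unfolding rising_poly_def by (induction rule: infinite_finite_induct) (simp_all add: smult_add_right)
  finally show ?thesis .
qed

lemma rising_poly_diff: "rising_poly (p - q) = rising_poly p - rising_poly q"
  using rising_poly_add[of p "smult (- 1) q"] rising_poly_smult[of "- 1" q] by simp

text \<open>By linearity the kernel decides; an element of the kernel has leading coefficient 0
  because the map preserves leading coefficients.\<close>

lemma inj_rising_poly: "inj rising_poly"
proof
  fix p q assume "rising_poly p = rising_poly q"
  then have "rising_poly (p - q) = 0"
    by (simp add: rising_poly_diff)
  then have "lead_coeff (p - q) = 0"
    using coeff_rising_poly[of "p - q" "degree (p - q)"] by (simp del: coeff_diff)
  then show "p = q"
    unfolding leading_coeff_0_iff by simp
qed

text \<open>Strong induction on the degree: the image of the leading monomial of \<open>q\<close>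
  has the same leading term as \<open>q\<close>, so subtracting it lowers the degree. Constants are
  fixed by the map and form the base case.\<close>

lemma surj_rising_poly: "surj rising_poly"
proof -
  have "\<exists>p. rising_poly p = q" for q
  proof (induction "degree q" arbitrary: q rule: less_induct)
    case less
    define m where "m = smult (lead_coeff q) (monom 1 (degree q))"
    have deg_m: "degree m \<le> degree q"
      unfolding m_def by (simp add: degree_monom_le smult_monom)
    have coeff_m: "coeff m (degree q) = lead_coeff q"
      by (simp add: m_def)
    show ?case
    proof (cases "degree q = 0")
      case True
      then obtain c where "q = [:c:]"
        by (rule degree_eq_zeroE)
      then have "rising_poly q = q"
        by (simp add: rising_poly_def)
      then show ?thesis by blast
    next
      case False
      have "degree (q - rising_poly m) < degree q"
      proof (rule ccontr)
        assume "\<not> ?thesis"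
        moreover have "degree (q - rising_poly m) \<le> degree q"
          using deg_m by (intro degree_diff_le) auto
        ultimately have "degree (q - rising_poly m) = degree q" by simp
        moreover have "coeff (q - rising_poly m) (degree q) = 0"
          using coeff_m coeff_rising_poly[OF deg_m] by simp
        ultimately have "q - rising_poly m = 0"
          by (metis leading_coeff_0_iff)
        with \<open>degree (q - rising_poly m) = degree q\<close> False show False
          by simp
      qed
      from less[OF this] obtain p where "rising_poly p = q - rising_poly m"
        by blast
      then have "rising_poly (p + m) = q"
        by (simp add: rising_poly_add)
      then show ?thesis by blast
    qed
  qed
  then show ?thesis by (metis surjI)
qed

section \<open>Integrals of polynomials against a Laguerre weight\<close>

lemma has_bochner_integral_laguerre_weight:
  assumes "\<alpha> > -1"
  shows "has_bochner_integral lborel (\<lambda>x. indicator {0..} x * laguerre_weight \<alpha> x) (Gamma (\<alpha> + 1))"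
proof (rule has_bochner_integral_nn_integral)
  have "ennreal (Gamma (\<alpha> + 1)) =
      (\<integral>\<^sup>+x. ennreal (indicator {0..} x * x powr (\<alpha> + 1 - 1) / exp x) \<partial>lborel)"
    using assms by (intro Gamma_conv_nn_integral_real) auto
  then show "(\<integral>\<^sup>+x. ennreal (indicator {0..} x * laguerre_weight \<alpha> x) \<partial>lborel) =
      ennreal (Gamma (\<alpha> + 1))"
    by (simp add: laguerre_weight_def exp_minus field_simps)
qed (use assms in \<open>auto simp: laguerre_weight_def intro!: less_imp_le Gamma_real_pos\<close>)

text \<open>At \<open>x = 0\<close> both sides vanish, even for \<open>k = 0\<close>, because
  \<open>0 powr \<alpha> = 0\<close>; the identity is thus pointwise on the closed
  half-line.\<close>

lemma power_times_laguerre_weight: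
  assumes "x \<ge> 0"
  shows "x ^ k * laguerre_weight \<alpha> x = laguerre_weight (\<alpha> + real k) x"
proof (cases "x = 0")
  case False
  with assms show ?thesis
    by (simp add: laguerre_weight_def powr_add powr_realpow)
qed (simp add: laguerre_weight_def)

lemma Gamma_add_of_nat:
  fixes \<alpha> :: real
  assumes "\<alpha> > -1"
  shows "Gamma (\<alpha> + real k + 1) = Gamma (\<alpha> + 1) * pochhammer (\<alpha> + 1) k"
proof -
  have "\<alpha> + 1 \<notin> \<int>\<^sub>\<le>\<^sub>0"
    using assms by (auto elim!: nonpos_Ints_cases)
  moreover from this have "Gamma (\<alpha> + 1) \<noteq> 0"
    by (simp add: Gamma_eq_zero_iff)
  ultimately show ?thesis
    by (simp add: pochhammer_Gamma add_ac)
qed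

text \<open>Each monomial \<open>x ^ k\<close> shifts the exponent by \<open>k\<close>, and the
  resulting Gamma value is \<open>Gamma (\<alpha> + 1)\<close> times a rising factorial.\<close>

lemma has_bochner_integral_poly_laguerre_weight:
  assumes "\<alpha> > -1"
  shows "has_bochner_integral lborel (\<lambda>x. indicator {0..} x * (poly p x * laguerre_weight \<alpha> x))
           (Gamma (\<alpha> + 1) * poly (rising_poly p) \<alpha>)"
proof -
  have "has_bochner_integral lborel
      (\<lambda>x. \<Sum>k\<le>degree p. coeff p k * (indicator {0..} x * laguerre_weight (\<alpha> + real k) x))
      (\<Sum>k\<le>degree p. coeff p k * Gamma (\<alpha> + real k + 1))"
    using assms
    by (intro has_bochner_integral_sum has_bochner_integral_mult_right
        has_bochner_integral_laguerre_weight) auto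
  also have "(\<lambda>x. \<Sum>k\<le>degree p. coeff p k * (indicator {0..} x * laguerre_weight (\<alpha> + real k) x)) =
      (\<lambda>x. indicator {0..} x * (poly p x * laguerre_weight \<alpha> x))"
    by (auto simp: fun_eq_iff indicator_def poly_altdef sum_distrib_right mult.assoc
        power_times_laguerre_weight intro!: sum.cong)
  also have "(\<Sum>k\<le>degree p. coeff p k * Gamma (\<alpha> + real k + 1)) =
      Gamma (\<alpha> + 1) * poly (rising_poly p) \<alpha>"
    using assms
    by (simp add: Gamma_add_of_nat poly_rising_poly[OF order.refl] sum_distrib_left mult_ac)
  finally show ?thesis .
qed

lemma laguerre_integral:
  assumes "\<alpha> > -1"
  shows "(LBINT x:{0..}. poly p x * laguerre_weight \<alpha> x) =
           Gamma (\<alpha> + 1) * poly (rising_poly p) \<alpha>"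
  using has_bochner_integral_integral_eq[OF has_bochner_integral_poly_laguerre_weight[OF assms]]
  by (simp add: set_lebesgue_integral_def)

text \<open>The power is absorbed into the weight instead of the polynomial, so the orthogonality
  condition of index \<open>j\<close> becomes evaluation at the node
  \<open>\<alpha> + j\<close>.\<close>

lemma laguerre_integral_power:
  assumes "\<alpha> > -1"
  shows "(LBINT x:{0..}. x ^ j * poly p x * laguerre_weight \<alpha> x) =
           Gamma (\<alpha> + real j + 1) * poly (rising_poly p) (\<alpha> + real j)"
proof -
  have "(LBINT x:{0..}. x ^ j * poly p x * laguerre_weight \<alpha> x) =
      (LBINT x:{0..}. poly p x * laguerre_weight (\<alpha> + real j) x)"
    by (intro set_lebesgue_integral_cong)
      (auto simp: power_times_laguerre_weight[symmetric] mult_ac)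
  then show ?thesis
    using assms by (simp add: laguerre_integral)
qed

section \<open>Divided differences\<close>

text \<open>
  Compare leading coefficients in Lagrange's interpolation formula.
\<close>
lemma sum_divided_difference:
  fixes p :: "'a :: field poly" and t :: "'b \<Rightarrow> 'a"
  assumes fin: "finite I" and inj: "inj_on t I" and deg: "degree p < card I"
  shows "(\<Sum>i\<in>I. poly p (t i) / (\<Prod>k\<in>I - {i}. t i - t k)) = coeff p (card I - 1)"
proof -
  \<comment> \<open>The quotient of \<open>l i\<close> by the constant \<open>d i\<close> is the
    Lagrange basis polynomial of the node \<open>t i\<close>, and \<open>q\<close> is the
    interpolant of \<open>p\<close>.\<close>
  define l where "l i = (\<Prod>k\<in>I - {i}. [:- t k, 1:])" for i
  define d where "d i = (\<Prod>k\<in>I - {i}. t i - t k)" for i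
  define q where "q = (\<Sum>i\<in>I. smult (poly p (t i) / d i) (l i))"
  have deg_l: "degree (l i) = card I - 1" if "i \<in> I" for i
    using that fin unfolding l_def by (subst degree_prod_eq_sum_degree) auto
  have lead_l: "coeff (l i) (card I - 1) = 1" if "i \<in> I" for i
    using lead_coeff_prod[of "\<lambda>k. [:- t k, 1:]" "I - {i}"] deg_l[OF that]
    unfolding l_def by simp
  have d_nz: "d i \<noteq> 0" if "i \<in> I" for i
    using that fin inj by (auto simp: d_def inj_on_def)
  have poly_l: "poly (l i) (t j) = (if i = j then d j else 0)" if "i \<in> I" "j \<in> I" for i j
    using that fin by (auto simp: l_def d_def poly_prod)
  have "p = q"
  proof (rule poly_eqI_degree[where A = "t ` I"])
    fix y assume "y \<in> t ` I"
    then obtain j where j: "j \<in> I" "y = t j" by blast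
    have "poly q y = (\<Sum>i\<in>I. if i = j then poly p (t j) else 0)"
      unfolding q_def j(2) poly_sum using j(1) d_nz by (intro sum.cong) (auto simp: poly_l)
    then show "poly p y = poly q y"
      using fin j by simp
  next
    have "degree q \<le> card I - 1"
      unfolding q_def using deg_l
      by (intro degree_sum_le fin order.trans[OF degree_smult_le]) auto
    then show "degree q < card (t ` I)"
      using deg by (simp add: card_image[OF inj])
  qed (use deg in \<open>simp add: card_image[OF inj]\<close>)
  then have "coeff p (card I - 1) = coeff q (card I - 1)"
    by simp
  also have "\<dots> = (\<Sum>i\<in>I. poly p (t i) / d i)"
    by (simp add: q_def coeff_sum lead_l del: One_nat_def)
  finally show ?thesis
    by (simp add: d_def)
qed

section \<open>The nodes and the type II polynomials\<close>

text \<open>A disjoint sum makes the two families of nodes a single indexed family, while the tag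
  still tells to which weight a node belongs.\<close>

abbreviation node_indices :: "nat \<Rightarrow> nat \<Rightarrow> (nat + nat) set" where
  "node_indices n1 n2 \<equiv> {..<n1} <+> {..<n2}"

definition node :: "real \<Rightarrow> real \<Rightarrow> nat + nat \<Rightarrow> real" where
  "node \<alpha>1 \<alpha>2 = case_sum (\<lambda>l. \<alpha>1 + real l) (\<lambda>l. \<alpha>2 + real l)"

lemma node_simps [simp]:
  "node \<alpha>1 \<alpha>2 (Inl l) = \<alpha>1 + real l" "node \<alpha>1 \<alpha>2 (Inr l) = \<alpha>2 + real l"
  by (simp_all add: node_def)

lemma inj_node:
  assumes "\<alpha>1 - \<alpha>2 \<notin> \<int>"
  shows "inj (node \<alpha>1 \<alpha>2)"
proof -
  have "\<alpha>1 + real l \<noteq> \<alpha>2 + real k" for l k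
  proof
    assume "\<alpha>1 + real l = \<alpha>2 + real k"
    then have "\<alpha>1 - \<alpha>2 = of_int (int k - int l)" by simp
    with assms show False by (metis Ints_of_int)
  qed
  then show ?thesis
    by (auto simp: inj_on_def node_def split: sum.splits) metis+
qed

lemma card_node_indices [simp]: "card (node_indices n1 n2) = n1 + n2"
  by (simp add: card_Plus)

lemma ball_Plus: "(\<forall>i\<in>A <+> B. P i) \<longleftrightarrow> (\<forall>a\<in>A. P (Inl a)) \<and> (\<forall>b\<in>B. P (Inr b))"
  by auto

text \<open>Since Gamma factors are nonzero, orthogonality says that \<open>rising_poly P\<close>
  vanishes at the \<open>m1 + m2\<close> distinct nodes. A monic polynomial of that degree is
  determined by these roots.\<close>

lemma is_laguerre_type_II_iff:
  assumes "\<alpha>1 > -1" and "\<alpha>2 > -1" and "\<alpha>1 - \<alpha>2 \<notin> \<int>"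
  shows "is_laguerre_type_II \<alpha>1 \<alpha>2 m1 m2 P \<longleftrightarrow>
           rising_poly P = (\<Prod>i\<in>node_indices m1 m2. [:- node \<alpha>1 \<alpha>2 i, 1:])"
    (is "_ \<longleftrightarrow> _ = ?Q")
proof -
  define t where "t = node \<alpha>1 \<alpha>2"
  define I where "I = node_indices m1 m2"
  have Gamma_nz: "Gamma (\<alpha> + real j + 1) \<noteq> 0" if "\<alpha> > -1" for \<alpha> j
    using that by (intro less_imp_neq[symmetric] Gamma_real_pos) auto
  have card_t: "card (t ` I) = m1 + m2"
    using inj_node[OF assms(3)] by (simp add: t_def I_def card_image inj_on_subset)
  have deg_Q: "degree ?Q = m1 + m2"
    by (subst degree_prod_eq_sum_degree) (auto simp: card_Plus)
  have lead_Q: "lead_coeff ?Q = 1"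
    using lead_coeff_prod[of "\<lambda>i. [:- node \<alpha>1 \<alpha>2 i, 1:]" "node_indices m1 m2"] by simp
  have root_Q: "poly ?Q (t i) = 0" if "i \<in> I" for i
    using that by (auto simp: poly_prod I_def t_def)
  have "is_laguerre_type_II \<alpha>1 \<alpha>2 m1 m2 P \<longleftrightarrow>
      lead_coeff P = 1 \<and> degree P = m1 + m2 \<and> (\<forall>i\<in>I. poly (rising_poly P) (t i) = 0)"
    using assms(1,2)
    by (auto simp: is_laguerre_type_II_def laguerre_integral_power Gamma_nz I_def t_def ball_Plus)
  also have "\<dots> \<longleftrightarrow> rising_poly P = ?Q"
  proof
    assume *: "lead_coeff P = 1 \<and> degree P = m1 + m2 \<and> (\<forall>i\<in>I. poly (rising_poly P) (t i) = 0)"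
    show "rising_poly P = ?Q"
    \<comment> \<open>The two leading terms cancel, so the difference has degree below
      \<open>m1 + m2\<close> or is 0, yet it vanishes at \<open>m1 + m2\<close> points.\<close>
    proof (rule poly_eqI_degree_lead_coeff[where n = "m1 + m2" and A = "t ` I"])
      show "coeff (rising_poly P) (m1 + m2) = coeff ?Q (m1 + m2)"
        using * lead_Q coeff_rising_poly[of P "m1 + m2"] unfolding deg_Q by auto
    qed (use * root_Q card_t deg_Q in auto)
  next
    assume *: "rising_poly P = ?Q"
    then have "degree P = m1 + m2"
      using degree_rising_poly[of P] deg_Q by simp
    moreover from this have "lead_coeff P = 1"
      using coeff_rising_poly[of P "m1 + m2"] * lead_Q deg_Q by simp
    ultimately show "lead_coeff P = 1 \<and> degree P = m1 + m2 \<and>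
        (\<forall>i\<in>I. poly (rising_poly P) (t i) = 0)"
      using root_Q * by simp
  qed
  finally show ?thesis .
qed

text \<open>Bijectivity of \<open>rising_poly\<close> yields existence and uniqueness, which give
  the \<open>THE\<close> in the definition its meaning.\<close>

lemma is_laguerre_type_II_laguerre_type_II:
  assumes "\<alpha>1 > -1" and "\<alpha>2 > -1" and "\<alpha>1 - \<alpha>2 \<notin> \<int>"
  shows "is_laguerre_type_II \<alpha>1 \<alpha>2 m1 m2 (laguerre_type_II \<alpha>1 \<alpha>2 m1 m2)"
  unfolding laguerre_type_II_def
proof (rule theI')
  have "\<exists>!P. rising_poly P = Q" for Q
    using inj_rising_poly surj_rising_poly by (metis injD surjD)
  then show "\<exists>!P. is_laguerre_type_II \<alpha>1 \<alpha>2 m1 m2 P"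
    unfolding is_laguerre_type_II_iff[OF assms] .
qed

section \<open>Type I pairs as functionals on the nodes\<close>

text \<open>Absorbing the Gamma factors turns the type I functional into a plain linear combination
  of point evaluations; these are its weights.\<close>

definition type_I_moment_coeff :: "real \<Rightarrow> real \<Rightarrow> real poly \<Rightarrow> real poly \<Rightarrow> nat + nat \<Rightarrow> real" where
  "type_I_moment_coeff \<alpha>1 \<alpha>2 A1 A2 =
     case_sum (\<lambda>l. coeff A1 l * Gamma (\<alpha>1 + real l + 1)) (\<lambda>l. coeff A2 l * Gamma (\<alpha>2 + real l + 1))"

lemma poly_eq_sum_lessThan:
  fixes A :: "'a :: comm_semiring_1 poly"
  assumes "A = 0 \<or> degree A < n"
  shows "poly A x = (\<Sum>l<n. coeff A l * x ^ l)"
proof -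
  have "(\<Sum>l<n. coeff A l * x ^ l) = (\<Sum>l\<le>degree A. coeff A l * x ^ l)" if "degree A < n"
    using that by (intro sum.mono_neutral_right) (auto simp: coeff_eq_0)
  with assms show ?thesis
    by (auto simp: poly_altdef)
qed

text \<open>Only \<open>A\<close> is expanded: its monomial of index \<open>l\<close> shifts the
  exponent to \<open>\<alpha> + l\<close>, and integrating \<open>R\<close> against the shifted
  weight evaluates \<open>rising_poly R\<close> at that node.\<close>

lemma has_bochner_integral_type_I_component:
  assumes "\<alpha> > -1" and "A = 0 \<or> degree A < n"
  shows "has_bochner_integral lborel
           (\<lambda>x. indicator {0..} x * (poly R x * (poly A x * laguerre_weight \<alpha> x)))
           (\<Sum>l<n. coeff A l * Gamma (\<alpha> + real l + 1) * poly (rising_poly R) (\<alpha> + real l))"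
proof -
  have "has_bochner_integral lborel
      (\<lambda>x. \<Sum>l<n. coeff A l *
        (indicator {0..} x * (poly R x * laguerre_weight (\<alpha> + real l) x)))
      (\<Sum>l<n. coeff A l * (Gamma (\<alpha> + real l + 1) * poly (rising_poly R) (\<alpha> + real l)))"
    using assms(1)
    by (intro has_bochner_integral_sum has_bochner_integral_mult_right
        has_bochner_integral_poly_laguerre_weight) auto
  also have "(\<lambda>x. \<Sum>l<n. coeff A l *
        (indicator {0..} x * (poly R x * laguerre_weight (\<alpha> + real l) x))) =
      (\<lambda>x. indicator {0..} x * (poly R x * (poly A x * laguerre_weight \<alpha> x)))"
    by (auto simp: fun_eq_iff indicator_def poly_eq_sum_lessThan[OF assms(2)]
        sum_distrib_left sum_distrib_right mult_ac simp flip: power_times_laguerre_weight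
        intro!: sum.cong)
  finally show ?thesis
    by (simp add: mult.assoc)
qed

lemma type_I_integral:
  assumes "\<alpha>1 > -1" and "\<alpha>2 > -1"
    and "A1 = 0 \<or> degree A1 < n1" and "A2 = 0 \<or> degree A2 < n2"
  shows "(LBINT x:{0..}. poly R x *
             (poly A1 x * laguerre_weight \<alpha>1 x + poly A2 x * laguerre_weight \<alpha>2 x)) =
         (\<Sum>i\<in>node_indices n1 n2.
            type_I_moment_coeff \<alpha>1 \<alpha>2 A1 A2 i * poly (rising_poly R) (node \<alpha>1 \<alpha>2 i))"
proof -
  have "has_bochner_integral lborel
      (\<lambda>x. indicator {0..} x * (poly R x * (poly A1 x * laguerre_weight \<alpha>1 x)) +
           indicator {0..} x * (poly R x * (poly A2 x * laguerre_weight \<alpha>2 x)))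
      ((\<Sum>l<n1. coeff A1 l * Gamma (\<alpha>1 + real l + 1) * poly (rising_poly R) (\<alpha>1 + real l)) +
       (\<Sum>l<n2. coeff A2 l * Gamma (\<alpha>2 + real l + 1) * poly (rising_poly R) (\<alpha>2 + real l)))"
    using assms by (intro has_bochner_integral_add has_bochner_integral_type_I_component)
  from has_bochner_integral_integral_eq[OF this] show ?thesis
    by (simp add: set_lebesgue_integral_def type_I_moment_coeff_def sum.Plus o_def algebra_simps)
qed

text \<open>Biorthogonality is first restated as \<open>F R = coeff R (N - 1)\<close> for all
  \<open>R\<close> of degree below \<open>N\<close>. Testing this on node polynomials gives the
  weights; conversely, divided differences with these weights extract the coefficient.\<close>

lemma is_laguerre_type_I_iff_moment_coeff:
  assumes "\<alpha>1 > -1" and "\<alpha>2 > -1" and "\<alpha>1 - \<alpha>2 \<notin> \<int>" and "n1 + n2 \<ge> 1"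
  shows "is_laguerre_type_I \<alpha>1 \<alpha>2 n1 n2 (A1, A2) \<longleftrightarrow>
     (A1 = 0 \<or> degree A1 < n1) \<and> (A2 = 0 \<or> degree A2 < n2) \<and>
     (\<forall>i\<in>node_indices n1 n2. type_I_moment_coeff \<alpha>1 \<alpha>2 A1 A2 i =
        1 / (\<Prod>k\<in>node_indices n1 n2 - {i}. node \<alpha>1 \<alpha>2 i - node \<alpha>1 \<alpha>2 k))"
proof (cases "(A1 = 0 \<or> degree A1 < n1) \<and> (A2 = 0 \<or> degree A2 < n2)")
  case deg: True
  define t where "t = node \<alpha>1 \<alpha>2"
  define I where "I = node_indices n1 n2"
  define N where "N = n1 + n2"
  define c where "c = type_I_moment_coeff \<alpha>1 \<alpha>2 A1 A2"
  define F where "F R = (\<Sum>i\<in>I. c i * poly (rising_poly R) (t i))" for R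
  define d where "d i = (\<Prod>k\<in>I - {i}. t i - t k)" for i
  define L where "L = laguerre_type_II \<alpha>1 \<alpha>2"
  have fin: "finite I" and card: "card I = N" and inj: "inj_on t I"
    using inj_node[OF assms(3)] by (auto simp: I_def N_def t_def inj_on_def)
  have F: "(LBINT x:{0..}. poly R x *
      (poly A1 x * laguerre_weight \<alpha>1 x + poly A2 x * laguerre_weight \<alpha>2 x)) = F R" for R
    using type_I_integral[OF assms(1,2), of A1 n1 A2 n2 R] deg
    by (simp add: F_def c_def I_def t_def)
  have F_power: "(LBINT x:{0..}. x ^ j *
      (poly A1 x * laguerre_weight \<alpha>1 x + poly A2 x * laguerre_weight \<alpha>2 x)) = F (monom 1 j)" for j
    using F[of "monom 1 j"] by (simp add: poly_monom)
  have L: "degree (L m1 m2) = m1 + m2" "coeff (L m1 m2) (m1 + m2) = 1" for m1 m2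
    using is_laguerre_type_II_laguerre_type_II[OF assms(1-3), of m1 m2]
    by (auto simp: is_laguerre_type_II_def L_def)
  have F_add: "F (p + q) = F p + F q" for p q
    by (simp add: F_def rising_poly_add sum.distrib algebra_simps)
  have F_smult: "F (smult a p) = a * F p" for a p
    by (simp add: F_def rising_poly_smult sum_distrib_left mult_ac)
  have F_sum: "F (\<Sum>k\<in>K. f k) = (\<Sum>k\<in>K. F (f k))" for f :: "nat \<Rightarrow> real poly" and K
    using F_smult[of 0 0]
    by (induction K rule: infinite_finite_induct) (simp_all add: F_add)
  have "is_laguerre_type_I \<alpha>1 \<alpha>2 n1 n2 (A1, A2) \<longleftrightarrow>
      (\<forall>j. j + 2 \<le> N \<longrightarrow> F (monom 1 j) = 0) \<and> (\<forall>m1 m2. m1 + m2 + 1 = N \<longrightarrow> F (L m1 m2) = 1)"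
    using deg by (simp add: is_laguerre_type_I_def F F_power L_def N_def)
  also have "\<dots> \<longleftrightarrow> (\<forall>R. degree R < N \<longrightarrow> F R = coeff R (N - 1))"
  proof (intro iffI allI impI)
    fix R :: "real poly"
    assume *: "(\<forall>j. j + 2 \<le> N \<longrightarrow> F (monom 1 j) = 0) \<and>
      (\<forall>m1 m2. m1 + m2 + 1 = N \<longrightarrow> F (L m1 m2) = 1)" and "degree R < N"
    \<comment> \<open>Subtracting a multiple of one type II polynomial of degree
      \<open>N - 1\<close> removes the top coefficient, so \<open>S\<close> is a combination of
      monomials that \<open>F\<close> annihilates.\<close>
    define S where "S = R - smult (coeff R (N - 1)) (L (N - 1) 0)"
    have deg_S: "degree S \<le> N - 1"
      unfolding S_def using \<open>degree R < N\<close> L(1)[of "N - 1" 0]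
      by (intro degree_diff_le order.trans[OF degree_smult_le]) auto
    have coeff_S: "coeff S (N - 1) = 0"
      using L(2)[of "N - 1" 0] by (simp add: S_def)
    have "F S = F (\<Sum>k\<le>N - 1. smult (coeff S k) (monom 1 k))"
      using poly_as_sum_of_monoms'[OF deg_S] by (simp add: smult_monom)
    also have "\<dots> = (\<Sum>k\<le>N - 1. coeff S k * F (monom 1 k))"
      by (simp add: F_sum F_smult)
    also have "\<dots> = 0"
    proof (intro sum.neutral ballI)
      fix k assume "k \<in> {..N - 1}"
      then show "coeff S k * F (monom 1 k) = 0"
        using * coeff_S by (cases "k = N - 1") auto
    qed
    finally have "F S = 0" .
    moreover have "F R = F S + coeff R (N - 1) * F (L (N - 1) 0)"
      unfolding F_smult[symmetric] F_add[symmetric] by (simp add: S_def)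
    moreover have "F (L (N - 1) 0) = 1"
      using * \<open>degree R < N\<close> by simp
    ultimately show "F R = coeff R (N - 1)" by simp
  next
    assume *: "\<forall>R. degree R < N \<longrightarrow> F R = coeff R (N - 1)"
    have "F (monom 1 j) = 0" if "j + 2 \<le> N" for j
      using that *[rule_format, of "monom 1 j"] by (simp add: degree_monom_eq)
    moreover have "F (L m1 m2) = 1" if "m1 + m2 + 1 = N" for m1 m2
      using that *[rule_format, of "L m1 m2"] L[of m1 m2] by auto
    ultimately show "(\<forall>j. j + 2 \<le> N \<longrightarrow> F (monom 1 j) = 0) \<and>
        (\<forall>m1 m2. m1 + m2 + 1 = N \<longrightarrow> F (L m1 m2) = 1)" by blast
  qed
  also have "\<dots> \<longleftrightarrow> (\<forall>i\<in>I. c i = 1 / d i)"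
  proof (intro iffI ballI allI impI)
    fix i assume *: "\<forall>R. degree R < N \<longrightarrow> F R = coeff R (N - 1)" and i: "i \<in> I"
    \<comment> \<open>This polynomial vanishes at every node except \<open>t i\<close>, so its
      preimage under \<open>rising_poly\<close> isolates the weight \<open>c i\<close>.\<close>
    define l where "l = (\<Prod>k\<in>I - {i}. [:- t k, 1:])"
    obtain R where R: "rising_poly R = l"
      using surj_rising_poly by (metis surjD)
    have deg_l: "degree l = N - 1"
      using i fin card unfolding l_def by (subst degree_prod_eq_sum_degree) auto
    have lead_l: "coeff l (N - 1) = 1"
      using lead_coeff_prod[of "\<lambda>k. [:- t k, 1:]" "I - {i}"] deg_l
      unfolding l_def by simp
    have deg_R: "degree R = N - 1"
      using R deg_l degree_rising_poly by metis
    have "F R = (\<Sum>j\<in>I. if j = i then c i * d i else 0)"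
      unfolding F_def R using i fin by (intro sum.cong) (auto simp: l_def d_def poly_prod)
    also have "\<dots> = c i * d i"
      using i fin by simp
    finally have "c i * d i = 1"
      using * deg_R assms(4) lead_l R coeff_rising_poly[of R "N - 1"] by (simp add: N_def)
    \<comment> \<open>The equation \<open>c i * d i = 1\<close> itself rules out
      \<open>d i = 0\<close>.\<close>
    then show "c i = 1 / d i"
      by (metis mult_zero_right nonzero_eq_divide_eq zero_neq_one)
  next
    fix R :: "real poly"
    assume *: "\<forall>i\<in>I. c i = 1 / d i" and "degree R < N"
    have "F R = (\<Sum>i\<in>I. poly (rising_poly R) (t i) / d i)"
      unfolding F_def using * by (intro sum.cong) auto
    also have "\<dots> = coeff (rising_poly R) (N - 1)"
      using sum_divided_difference[OF fin inj, of "rising_poly R"] \<open>degree R < N\<close>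
      by (simp add: d_def card)
    also have "\<dots> = coeff R (N - 1)"
      using \<open>degree R < N\<close> by (intro coeff_rising_poly) auto
    finally show "F R = coeff R (N - 1)" .
  qed
  finally show ?thesis
    using deg by (simp add: c_def d_def I_def t_def)
qed (auto simp: is_laguerre_type_I_def)

section \<open>Explicit coefficients of the type I pair\<close>

text \<open>The weight of a node divided by its Gamma factor, with node differences inside the own
  family (\<open>\<alpha>\<close>, \<open>n\<close>) separated from those to the other family
  (\<open>\<beta>\<close>, \<open>m\<close>). Exchanging the families gives the other
  component.\<close>

definition type_I_coeff :: "real \<Rightarrow> real \<Rightarrow> nat \<Rightarrow> nat \<Rightarrow> nat \<Rightarrow> real" where
  "type_I_coeff \<alpha> \<beta> n m l =
     1 / (Gamma (\<alpha> + real l + 1) * ((\<Prod>k\<in>{..<n} - {l}. real l - real k) *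
       (\<Prod>k<m. \<alpha> - \<beta> + real l - real k)))"

lemma prod_node_diff_Inl:
  "(\<Prod>k\<in>node_indices n1 n2 - {Inl l}. node \<alpha>1 \<alpha>2 (Inl l) - node \<alpha>1 \<alpha>2 k) =
     (\<Prod>k\<in>{..<n1} - {l}. real l - real k) * (\<Prod>k<n2. \<alpha>1 - \<alpha>2 + real l - real k)"
proof -
  have "node_indices n1 n2 - {Inl l} = ({..<n1} - {l}) <+> {..<n2}"
    by auto
  then show ?thesis
    by (simp add: prod.Plus o_def algebra_simps)
qed

lemma prod_node_diff_Inr:
  "(\<Prod>k\<in>node_indices n1 n2 - {Inr l}. node \<alpha>1 \<alpha>2 (Inr l) - node \<alpha>1 \<alpha>2 k) =
     (\<Prod>k\<in>{..<n2} - {l}. real l - real k) * (\<Prod>k<n1. \<alpha>2 - \<alpha>1 + real l - real k)"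
proof -
  have "node_indices n1 n2 - {Inr l} = {..<n1} <+> ({..<n2} - {l})"
    by auto
  then show ?thesis
    by (simp add: prod.Plus o_def algebra_simps)
qed

definition type_I_poly :: "real \<Rightarrow> real \<Rightarrow> nat \<Rightarrow> nat \<Rightarrow> real poly" where
  "type_I_poly \<alpha> \<beta> n m = (\<Sum>l<n. monom (type_I_coeff \<alpha> \<beta> n m l) l)"

lemma coeff_type_I_poly: "coeff (type_I_poly \<alpha> \<beta> n m) l = (if l < n then type_I_coeff \<alpha> \<beta> n m l else 0)"
  by (simp add: type_I_poly_def coeff_sum)

text \<open>With the degree bounds in this form, a type I pair is determined coefficient by
  coefficient.\<close>

lemma eq_zero_or_degree_less_iff: "A = 0 \<or> degree A < n \<longleftrightarrow> (\<forall>l\<ge>n. coeff A l = 0)"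
  by (metis coeff_0 coeff_eq_0 leading_coeff_0_iff linorder_not_less order_less_le_trans)

lemma is_laguerre_type_I_iff:
  assumes "\<alpha>1 > -1" and "\<alpha>2 > -1" and "\<alpha>1 - \<alpha>2 \<notin> \<int>" and "n1 + n2 \<ge> 1"
  shows "is_laguerre_type_I \<alpha>1 \<alpha>2 n1 n2 (A1, A2) \<longleftrightarrow>
           A1 = type_I_poly \<alpha>1 \<alpha>2 n1 n2 \<and> A2 = type_I_poly \<alpha>2 \<alpha>1 n2 n1"
proof -
  have Gamma_nz: "Gamma (\<alpha> + real l + 1) \<noteq> 0" if "\<alpha> > -1" for \<alpha> l
    using that by (intro less_imp_neq[symmetric] Gamma_real_pos) auto
  \<comment> \<open>For \<open>q = 0\<close> both quotients are 0, so the equivalence holds for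
    every \<open>q\<close>.\<close>
  have solve: "a * Gamma (\<alpha> + real l + 1) = 1 / q \<longleftrightarrow> a = 1 / (Gamma (\<alpha> + real l + 1) * q)"
    if "\<alpha> > -1" for a q \<alpha> l
    using Gamma_nz[OF that, of l] by (cases "q = 0") (auto simp: field_simps)
  show ?thesis
    unfolding is_laguerre_type_I_iff_moment_coeff[OF assms] eq_zero_or_degree_less_iff
      ball_Plus prod_node_diff_Inl prod_node_diff_Inr
    using assms(1,2)
    by (auto simp: poly_eq_iff coeff_type_I_poly type_I_moment_coeff_def type_I_coeff_def solve)
qed

lemma laguerre_type_I_eq:
  assumes "\<alpha>1 > -1" and "\<alpha>2 > -1" and "\<alpha>1 - \<alpha>2 \<notin> \<int>" and "n1 + n2 \<ge> 1"
  shows "laguerre_type_I \<alpha>1 \<alpha>2 n1 n2 = (type_I_poly \<alpha>1 \<alpha>2 n1 n2, type_I_poly \<alpha>2 \<alpha>1 n2 n1)"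
  unfolding laguerre_type_I_def
  by (rule the_equality) (use is_laguerre_type_I_iff[OF assms] in auto)

section \<open>Node products as Pochhammer symbols\<close>

lemma prod_falling_eq_pochhammer:
  fixes a :: "'a :: comm_ring_1"
  shows "(\<Prod>k<m. a - of_nat k) = pochhammer (a - of_nat m + 1) m"
proof (induction m)
  case (Suc m)
  have "pochhammer (a - of_nat (Suc m) + 1) (Suc m) = (a - of_nat m) * pochhammer (a - of_nat m + 1) m"
    by (simp add: pochhammer_rec)
  with Suc.IH show ?case
    by (simp add: mult.commute)
qed simp

text \<open>The product is \<open>(- 1) ^ (n - 1 - l) * fact l * fact (n - 1 - l)\<close>, and the
  Pochhammer symbol is \<open>(- 1) ^ l * fact (n - 1) / fact (n - 1 - l)\<close>. The induction on
  \<open>n\<close> starts at \<open>l + 1\<close> and avoids the quotient.\<close>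

lemma prod_diff_times_pochhammer:
  assumes "l < n"
  shows "(\<Prod>k\<in>{..<n} - {l}. real l - real k) * pochhammer (- real n + 1) l =
           (- 1) ^ (n - 1) * fact (n - 1) * fact l"
proof -
  have "Suc l \<le> n" using assms by simp
  then show ?thesis
  proof (induction n rule: dec_induct)
    case base
    have "{..<Suc l} - {l} = {..<l}" by auto
    moreover have "(\<Prod>k<l. real l - real k) = fact l"
      by (simp add: prod_falling_eq_pochhammer pochhammer_fact)
    ultimately show ?case
      by (simp add: pochhammer_same)
  next
    case (step n)
    have "{..<Suc n} - {l} = insert n ({..<n} - {l})"
      using step.hyps by auto
    then have "(\<Prod>k\<in>{..<Suc n} - {l}. real l - real k) * pochhammer (- real (Suc n) + 1) l =
        (\<Prod>k\<in>{..<n} - {l}. real l - real k) * (pochhammer (- real n) l * (- real n + real l))"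
      by (simp add: algebra_simps)
    \<comment> \<open>Both sides are \<open>pochhammer (- real n) (Suc l)\<close>, with the last and
      with the first factor split off.\<close>
    also have "pochhammer (- real n) l * (- real n + real l) =
        - real n * pochhammer (- real n + 1) l"
      by (simp only: pochhammer_Suc[symmetric] pochhammer_rec)
    also have "(\<Prod>k\<in>{..<n} - {l}. real l - real k) * (- real n * pochhammer (- real n + 1) l) =
        - real n * ((- 1) ^ (n - 1) * fact (n - 1) * fact l)"
      unfolding step.IH[symmetric] by simp
    also have "\<dots> = (- 1) ^ (Suc n - 1) * fact (Suc n - 1) * fact l"
      using step.hyps by (cases n) (auto simp: algebra_simps)
    finally show ?case .
  qed
qed

text \<open>Up to reflection of the factor of length \<open>m\<close>, both sides are the rising
  factorial of \<open>d - m + 1\<close> of length \<open>l + m\<close>, split after \<open>l\<close>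
  and after \<open>m\<close> factors.\<close>

lemma prod_shifted_diff_times_pochhammer:
  fixes d :: real
  shows "(\<Prod>k<m. d + real l - real k) * pochhammer (d - real m + 1) l =
           (- 1) ^ m * pochhammer (- d) m * pochhammer (d + 1) l"
proof -
  have "(\<Prod>k<m. d + real l - real k) * pochhammer (d - real m + 1) l =
      pochhammer (d - real m + 1) (l + m)"
    by (simp add: prod_falling_eq_pochhammer pochhammer_product' algebra_simps)
  also have "\<dots> = pochhammer (d - real m + 1) m * pochhammer (d + 1) l"
    unfolding add.commute[of l m] pochhammer_product' by simp
  also have "pochhammer (d - real m + 1) m = (- 1) ^ m * pochhammer (- d) m"
    using pochhammer_minus'[of d m] by (simp add: mult_ac)
  finally show ?thesis .
qed

lemma type_I_coeff_eq:
  assumes "\<alpha> > -1" and "\<alpha> - \<beta> \<notin> \<int>" and "l < n"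
  shows "type_I_coeff \<alpha> \<beta> n m l =
    (- 1) ^ (n + m - 1) / (fact (n - 1) * Gamma (\<alpha> + 1) * pochhammer (\<beta> - \<alpha>) m) *
    (pochhammer (- real n + 1) l / fact l *
      (pochhammer (\<alpha> - \<beta> - real m + 1) l /
        (pochhammer (\<alpha> + 1) l * pochhammer (\<alpha> - \<beta> + 1) l)))"
proof -
  define X where "X = (\<Prod>k\<in>{..<n} - {l}. real l - real k)"
  define Y where "Y = (\<Prod>k<m. \<alpha> - \<beta> + real l - real k)"
  define u where "u = pochhammer (- real n + 1) l"
  define v where "v = pochhammer (\<alpha> - \<beta> - real m + 1) l"
  have nonint: "pochhammer (\<alpha> - \<beta> + of_int i) k \<noteq> 0" for i k
  proof
    assume "pochhammer (\<alpha> - \<beta> + of_int i) k = 0"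
    then obtain j where "\<alpha> - \<beta> + of_int i = - of_nat j"
      by (auto simp: pochhammer_eq_0_iff)
    then have "\<alpha> - \<beta> = of_int (- int j - i)" by simp
    with assms(2) show False by (metis Ints_of_int)
  qed
  have X: "X * u = (- 1) ^ (n - 1) * fact (n - 1) * fact l"
    unfolding X_def u_def by (rule prod_diff_times_pochhammer[OF assms(3)])
  have Y: "Y * v = (- 1) ^ m * pochhammer (\<beta> - \<alpha>) m * pochhammer (\<alpha> - \<beta> + 1) l"
    using prod_shifted_diff_times_pochhammer[where d = "\<alpha> - \<beta>"] by (simp add: Y_def v_def)
  \<comment> \<open>The right-hand side of \<open>X\<close> is a sign times factorials, hence
    nonzero.\<close>
  have "u \<noteq> 0"
    using X by auto
  have "v \<noteq> 0"
    using nonint[of "1 - int m" l] by (simp add: v_def algebra_simps)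
  have "type_I_coeff \<alpha> \<beta> n m l = 1 / (Gamma (\<alpha> + 1) * pochhammer (\<alpha> + 1) l * (X * Y))"
    by (simp add: type_I_coeff_def X_def Y_def Gamma_add_of_nat[OF assms(1)])
  \<comment> \<open>Expanding by the upper Pochhammer symbols puts them into the numerator and makes
    the closed forms \<open>X\<close> and \<open>Y\<close> applicable.\<close>
  also have "\<dots> = u * v / (Gamma (\<alpha> + 1) * pochhammer (\<alpha> + 1) l * ((X * u) * (Y * v)))"
    using \<open>u \<noteq> 0\<close> \<open>v \<noteq> 0\<close> by simp
  also have "\<dots> = 1 / ((- 1) ^ (n - 1) * (- 1) ^ m) * (u * v / (Gamma (\<alpha> + 1) * pochhammer (\<alpha> + 1) l *
      (fact (n - 1) * fact l * (pochhammer (\<beta> - \<alpha>) m * pochhammer (\<alpha> - \<beta> + 1) l))))"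
    unfolding X Y by (simp add: mult_ac)
  \<comment> \<open>A sign is its own inverse, and \<open>l < n\<close> makes
    \<open>n - 1 + m\<close> equal to \<open>n + m - 1\<close>.\<close>
  also have "1 / ((- 1) ^ (n - 1) * (- 1) ^ m) = (- 1 :: real) ^ (n + m - 1)"
    using assms(3) by (cases n) (simp_all flip: power_add add: power_one_over[symmetric])
  finally show ?thesis
    by (simp add: u_def v_def)
qed

section \<open>The hypergeometric form\<close>

lemma poly_type_I_poly:
  assumes "\<alpha> > -1" and "\<alpha> - \<beta> \<notin> \<int>" and "n \<ge> 1"
  shows "poly (type_I_poly \<alpha> \<beta> n m) x =
    (- 1) ^ (n + m - 1) / (fact (n - 1) * Gamma (\<alpha> + 1) * pochhammer (\<beta> - \<alpha>) m) *
    (\<Sum>l=0..n-1. pochhammer (- real n + 1) l / fact l *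
      (pochhammer (\<alpha> - \<beta> - real m + 1) l /
        (pochhammer (\<alpha> + 1) l * pochhammer (\<alpha> - \<beta> + 1) l)) * x ^ l)"
proof -
  have "{0..n-1} = {..<n}"
    using assms(3) by auto
  then show ?thesis
    unfolding type_I_poly_def poly_sum poly_monom sum_distrib_left
    by (intro sum.cong) (simp_all add: type_I_coeff_eq[OF assms(1,2)])
qed

text \<open>The upper parameter \<open>1 - n\<close> is a nonpositive integer, so its Pochhammer
  symbols vanish from index \<open>n\<close> on and the series is a finite sum.\<close>

lemma hypergeo_terminating:
  assumes "n \<ge> 1"
  shows "hypergeo [- real n + 1, a] [b, c] x =
    (\<Sum>l=0..n-1. pochhammer (- real n + 1) l / fact l *
      (pochhammer a l / (pochhammer b l * pochhammer c l)) * x ^ l)"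
proof -
  have zero: "pochhammer (1 - real n) l = 0" if "n \<le> l" for l
    using that assms by (auto simp: pochhammer_eq_0_iff of_nat_diff intro!: exI[of _ "n - 1"])
  have "hypergeo [- real n + 1, a] [b, c] x =
      (\<Sum>l=0..n-1. fps_nth (fps_hypergeo [- real n + 1, a] [b, c] 1) l * x ^ l)"
    unfolding hypergeo_def eval_fps_def by (rule suminf_finite) (use assms in \<open>auto simp: zero\<close>)
  then show ?thesis
    by (simp add: mult_ac)
qed

theorem proposition7p1:
  fixes \<alpha>1 \<alpha>2 x :: real and n1 n2 :: nat
  assumes "\<alpha>1 > -1" and "\<alpha>2 > -1" and "\<alpha>1 - \<alpha>2 \<notin> \<int>"
    and "n1 \<ge> 1" and "n2 \<ge> 1"
  shows
    "poly (laguerre_type_I_1 \<alpha>1 \<alpha>2 n1 n2) x =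
       (-1) ^ (n1 + n2 - 1) / (fact (n1 - 1) * Gamma (\<alpha>1 + 1) * pochhammer (\<alpha>2 - \<alpha>1) n2) *
       hypergeo [- real n1 + 1, \<alpha>1 - \<alpha>2 - real n2 + 1] [\<alpha>1 + 1, \<alpha>1 - \<alpha>2 + 1] x \<and>
     poly (laguerre_type_I_1 \<alpha>1 \<alpha>2 n1 n2) x =
       (-1) ^ (n1 + n2 - 1) / (fact (n1 - 1) * Gamma (\<alpha>1 + 1) * pochhammer (\<alpha>2 - \<alpha>1) n2) *
       (\<Sum>l=0..n1-1. pochhammer (- real n1 + 1) l / fact l *
          (pochhammer (\<alpha>1 - \<alpha>2 - real n2 + 1) l /
             (pochhammer (\<alpha>1 + 1) l * pochhammer (\<alpha>1 - \<alpha>2 + 1) l)) * x ^ l) \<and>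
     poly (laguerre_type_I_2 \<alpha>1 \<alpha>2 n1 n2) x =
       (-1) ^ (n1 + n2 - 1) / (fact (n2 - 1) * Gamma (\<alpha>2 + 1) * pochhammer (\<alpha>1 - \<alpha>2) n1) *
       hypergeo [- real n2 + 1, \<alpha>2 - \<alpha>1 - real n1 + 1] [\<alpha>2 + 1, \<alpha>2 - \<alpha>1 + 1] x \<and>
     poly (laguerre_type_I_2 \<alpha>1 \<alpha>2 n1 n2) x =
       (-1) ^ (n1 + n2 - 1) / (fact (n2 - 1) * Gamma (\<alpha>2 + 1) * pochhammer (\<alpha>1 - \<alpha>2) n1) *
       (\<Sum>l=0..n2-1. pochhammer (- real n2 + 1) l / fact l *
          (pochhammer (\<alpha>2 - \<alpha>1 - real n1 + 1) l /
             (pochhammer (\<alpha>2 + 1) l * pochhammer (\<alpha>2 - \<alpha>1 + 1) l)) * x ^ l)"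

proof -
  \<comment> \<open>The second component is the same formula with the two families exchanged, which
    calls for the difference with the opposite sign.\<close>
  have "\<alpha>2 - \<alpha>1 \<notin> \<int>"
    using assms(3) Ints_minus[of "\<alpha>2 - \<alpha>1"] by auto
  moreover have "laguerre_type_I \<alpha>1 \<alpha>2 n1 n2 =
      (type_I_poly \<alpha>1 \<alpha>2 n1 n2, type_I_poly \<alpha>2 \<alpha>1 n2 n1)"
    using assms by (intro laguerre_type_I_eq) auto
  ultimately show ?thesis
    using assms(1-5)
    unfolding laguerre_type_I_1_def laguerre_type_I_2_def hypergeo_terminating[OF assms(4)]
      hypergeo_terminating[OF assms(5)]
    by (simp only: fst_conv snd_conv poly_type_I_poly add.commute[of n2 n1] simp_thms)
qed

end
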